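(* Let $T\in \mathcal{B}_A(\mathcal{H})$. Then $$d\omega_A(T) \leq \sqrt{\frac{1}{2}\,\omega_A\Big(T^\sharp T + 2 (T^\sharp T)^2 + TT^\sharp \Big)-\frac{1}{2}\,\inf_{\|x\|_A = 1}\big(\|Tx\|_A - \|T^\sharp x\|_A\big)^2}.$$
   Context: $\mathcal{H}$ is a complex Hilbert space with inner product $\langle\cdot\mid\cdot\rangle$, $\mathcal{B}(\mathcal{H})$ is the algebra of bounded linear operators on $\mathcal{H}$, and $A\in\mathcal{B}(\mathcal{H})$ is a fixed nonzero positive (semidefinite) operator. Put $\langle x\mid y\rangle_A=\langle Ax\mid y\rangle$ and $\|x\|_A=\langle x\mid x\rangle_A^{1/2}$. $\mathcal{B}_A(\mathcal{H})=\{T\in\mathcal{B}(\mathcal{H}) : \mathcal{R}(T^*A)\subseteq\mathcal{R}(A)\}$, where $\mathcal{R}$ denotes range; for $T\in\mathcal{B}_A(\mathcal{H})$, $T^\sharp$ denotes the unique $X\in\mathcal{B}(\mathcal{H})$ with $AX=T^*A$ and $\mathcal{R}(X)\subseteq\overline{\mathcal{R}(A)}$ (so $\langle Tx\mid y\rangle_A=\langle x\mid T^\sharp y\rangle_A$). For $T\in\mathcal{B}_A(\mathcal{H})$: $\omega_A(T)=\sup\{|\langle Tx\mid x\rangle_A| : \|x\|_A=1\}$, and the $A$-Davis-Wielandt radius is $d\omega_A(T)=\sup\{\sqrt{|\langle Tx\mid x\rangle_A|^2+\|Tx\|_A^4} : \|x\|_A=1\}$; both are finite. *)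

theory Defs
  imports "HOL-Analysis.Analysis"
begin

class complex_vector = real_vector +
  fixes scaleC :: "complex \<Rightarrow> 'a \<Rightarrow> 'a"  (infixr "*\<^sub>C" 75)
  assumes scaleC_add_right: "c *\<^sub>C (x + y) = c *\<^sub>C x + c *\<^sub>C y"
    and scaleC_add_left: "(c + d) *\<^sub>C x = c *\<^sub>C x + d *\<^sub>C x"
    and scaleC_scaleC: "c *\<^sub>C (d *\<^sub>C x) = (c * d) *\<^sub>C x"
    and scaleC_one: "1 *\<^sub>C x = x"
    and scaleR_scaleC: "r *\<^sub>R x = complex_of_real r *\<^sub>C x"

text \<open>The inner product is linear in its first argument and conjugate-linear in the second.
  Norm, distance and topology are those of the library class, tied to the inner product by
  the last axiom.\<close>

class complex_inner = complex_vector + real_normed_vector +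
  fixes cinner :: "'a \<Rightarrow> 'a \<Rightarrow> complex"
  assumes cinner_commute: "cinner x y = cnj (cinner y x)"
    and cinner_add_left: "cinner (x + y) z = cinner x z + cinner y z"
    and cinner_scaleC_left: "cinner (c *\<^sub>C x) y = c * cinner x y"
    and cinner_self_nonneg: "cinner x x \<in> \<real>\<^sub>\<ge>\<^sub>0"
    and cinner_eq_zero_iff: "cinner x x = 0 \<longleftrightarrow> x = 0"
    and norm_eq_sqrt_cinner: "norm x = sqrt (Re (cinner x x))"

class chilbert_space = complex_inner + complete_space

instantiation complex :: chilbert_space
begin

definition scaleC_complex :: "complex \<Rightarrow> complex \<Rightarrow> complex"
  where "scaleC_complex c x = c * x"

definition cinner_complex :: "complex \<Rightarrow> complex \<Rightarrow> complex"
  where "cinner_complex x y = x * cnj y"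

instance
proof
  fix x :: complex
  have "cinner x x = complex_of_real ((cmod x)\<^sup>2)"
    unfolding cinner_complex_def complex_norm_square ..
  then show "cinner x x \<in> \<real>\<^sub>\<ge>\<^sub>0" "norm x = sqrt (Re (cinner x x))"
    by (simp_all del: of_real_power)
qed (auto simp: scaleC_complex_def cinner_complex_def algebra_simps scaleR_conv_of_real)

end

definition bounded_clinear :: "('a::complex_inner \<Rightarrow> 'a) \<Rightarrow> bool"
  where "bounded_clinear T \<longleftrightarrow> bounded_linear T \<and> (\<forall>c x. T (c *\<^sub>C x) = c *\<^sub>C T x)"

definition positive_op :: "('a::complex_inner \<Rightarrow> 'a) \<Rightarrow> bool"
  where "positive_op A \<longleftrightarrow> bounded_clinear A \<and> (\<forall>x. cinner (A x) x \<in> \<real>\<^sub>\<ge>\<^sub>0)"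

definition cadjoint :: "('a::chilbert_space \<Rightarrow> 'a) \<Rightarrow> ('a \<Rightarrow> 'a)"
  where "cadjoint T =
    (THE S. bounded_clinear S \<and> (\<forall>x y. cinner (T x) y = cinner x (S y)))"

definition inner_A :: "('a::complex_inner \<Rightarrow> 'a) \<Rightarrow> 'a \<Rightarrow> 'a \<Rightarrow> complex"
  where "inner_A A x y = cinner (A x) y"

text \<open>For positive \<open>A\<close> the number \<open>inner_A A x x\<close> is real and nonnegative, so taking its real
  part loses nothing.\<close>

definition norm_A :: "('a::complex_inner \<Rightarrow> 'a) \<Rightarrow> 'a \<Rightarrow> real"
  where "norm_A A x = sqrt (Re (inner_A A x x))"

definition B_A :: "('a::chilbert_space \<Rightarrow> 'a) \<Rightarrow> ('a \<Rightarrow> 'a) set"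
  where "B_A A = {T. bounded_clinear T \<and> range (cadjoint T \<circ> A) \<subseteq> range A}"

definition sharp :: "('a::chilbert_space \<Rightarrow> 'a) \<Rightarrow> ('a \<Rightarrow> 'a) \<Rightarrow> ('a \<Rightarrow> 'a)"
  where "sharp A T =
    (THE X. bounded_clinear X \<and> A \<circ> X = cadjoint T \<circ> A \<and> range X \<subseteq> closure (range A))"

text \<open>The suprema below are taken in the reals; they are meaningful for nonzero positive \<open>A\<close> and
  \<open>T \<in> B_A A\<close>, when the index set is nonempty and the values are bounded.\<close>

definition omega_A :: "('a::complex_inner \<Rightarrow> 'a) \<Rightarrow> ('a \<Rightarrow> 'a) \<Rightarrow> real"
  where "omega_A A T = (SUP x\<in>{x. norm_A A x = 1}. cmod (inner_A A (T x) x))"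

definition davis_wielandt_A :: "('a::complex_inner \<Rightarrow> 'a) \<Rightarrow> ('a \<Rightarrow> 'a) \<Rightarrow> real"
  where "davis_wielandt_A A T =
    (SUP x\<in>{x. norm_A A x = 1}. sqrt ((cmod (inner_A A (T x) x))\<^sup>2 + norm_A A (T x) ^ 4))"

end

theory Submission
  imports Defs
begin

text \<open>For \<open>norm_A A x = 1\<close> put \<open>a = norm_A A (T x)\<close>, \<open>b = norm_A A (U x)\<close> and
  \<open>d = norm_A A (U (T x))\<close>, where \<open>U\<close> is the A-adjoint of \<open>T\<close>. Cauchy--Schwarz applied to
  \<open>\<langle>Tx | x\<rangle>\<close> and \<open>\<langle>x | Ux\<rangle>\<close> bounds the numerical value by both \<open>a\<close> and \<open>b\<close>, so its square is at
  most \<open>a b = (a\<^sup>2 + b\<^sup>2 - (a - b)\<^sup>2) / 2\<close>; applied to \<open>a\<^sup>2 = \<langle>x | UTx\<rangle>\<close> it gives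
  \<open>a\<^sup>4 \<le> d\<^sup>2\<close>. Finally \<open>a\<^sup>2 + 2 d\<^sup>2 + b\<^sup>2\<close> is the value at \<open>x\<close> of the form of
  \<open>S = UT + 2 (UT)\<^sup>2 + TU\<close>. The supremum over these values is finite because \<open>S\<close> is bounded and
  A-symmetric, hence bounded for the A-seminorm.\<close>

section \<open>Sesquilinearity of the inner product and its norm\<close>

lemma cinner_add_right: "cinner x (y + z) = cinner x y + cinner x z"
  by (simp add: cinner_commute [of x] cinner_add_left)

lemma cinner_scaleC_right: "cinner x (c *\<^sub>C y) = cnj c * cinner x y"
  by (simp add: cinner_commute [of x] cinner_scaleC_left)

lemma cinner_zero_left [simp]: "cinner 0 x = 0"
  using cinner_add_left [of 0 0 x] by simp

lemma cinner_zero_right [simp]: "cinner x 0 = 0"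
  using cinner_add_right [of x 0 0] by simp

lemma cinner_minus_left: "cinner (- x) y = - cinner x y"
  using cinner_add_left [of x "- x" y] by (simp add: eq_neg_iff_add_eq_0 add.commute)

lemma cinner_minus_right: "cinner x (- y) = - cinner x y"
  using cinner_add_right [of x y "- y"] by (simp add: eq_neg_iff_add_eq_0 add.commute)

lemma cinner_diff_left: "cinner (x - y) z = cinner x z - cinner y z"
  using cinner_add_left [of x "- y" z] by (simp add: cinner_minus_left)

lemma cinner_diff_right: "cinner x (y - z) = cinner x y - cinner x z"
  using cinner_add_right [of x y "- z"] by (simp add: cinner_minus_right)

lemmas cinner_simps = cinner_add_left cinner_add_right cinner_diff_left cinner_diff_right
  cinner_minus_left cinner_minus_right cinner_scaleC_left cinner_scaleC_right

lemma cinner_self: "cinner x x = of_real ((norm x)\<^sup>2)"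
proof -
  have "Re (cinner x x) \<ge> 0" "Im (cinner x x) = 0"
    using cinner_self_nonneg [of x] by (auto simp: complex_nonneg_Reals_iff)
  then show ?thesis
    by (simp add: norm_eq_sqrt_cinner complex_eq_iff)
qed

lemma cinner_ext_left:
  assumes "\<And>z. cinner x z = cinner y z" shows "x = y"
proof -
  have "cinner (x - y) (x - y) = 0" using assms by (simp add: cinner_diff_left)
  then show ?thesis by (simp add: cinner_eq_zero_iff)
qed

lemma cinner_ext_right:
  assumes "\<And>z. cinner z x = cinner z y" shows "x = y"
  by (rule cinner_ext_left) (simp add: cinner_commute [of x] cinner_commute [of y] assms)

lemma norm_scaleC: "norm (c *\<^sub>C (x::'a::complex_inner)) = cmod c * norm x"
proof -
  have "complex_of_real ((norm (c *\<^sub>C x))\<^sup>2) = c * cnj c * of_real ((norm x)\<^sup>2)"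
    unfolding cinner_self [symmetric] by (simp add: cinner_simps)
  also have "\<dots> = of_real ((cmod c * norm x)\<^sup>2)"
    by (simp add: complex_norm_square [symmetric] power_mult_distrib)
  finally have "(norm (c *\<^sub>C x))\<^sup>2 = (cmod c * norm x)\<^sup>2"
    unfolding of_real_eq_iff .
  then show ?thesis by (simp add: power2_eq_iff_nonneg)
qed

section \<open>Bounded complex-linear operators\<close>

lemma bounded_clinear_imp_bounded_linear: "bounded_clinear T \<Longrightarrow> bounded_linear T"
  and bounded_clinear_scaleC: "bounded_clinear T \<Longrightarrow> T (c *\<^sub>C x) = c *\<^sub>C T x"
  by (auto simp: bounded_clinear_def)

lemma bounded_clinear_add: "bounded_clinear T \<Longrightarrow> T (x + y) = T x + T y"
  and bounded_clinear_diff: "bounded_clinear T \<Longrightarrow> T (x - y) = T x - T y"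
  and bounded_clinear_zero: "bounded_clinear T \<Longrightarrow> T 0 = 0"
  by (auto simp: bounded_clinear_def linear_simps bounded_linear.linear linear_0)

lemmas bounded_clinear_simps = bounded_clinear_add bounded_clinear_diff bounded_clinear_zero
  bounded_clinear_scaleC

lemma bounded_clinearI:
  fixes T :: "'a::complex_inner \<Rightarrow> 'a"
  assumes "\<And>x y. T (x + y) = T x + T y" and scale: "\<And>c x. T (c *\<^sub>C x) = c *\<^sub>C T x"
    and "\<And>x. norm (T x) \<le> K * norm x"
  shows "bounded_clinear T"
  unfolding bounded_clinear_def
proof (intro conjI allI scale)
  show "bounded_linear T"
    by (rule bounded_linear_intro [where K = K]) (use assms in \<open>auto simp: scaleR_scaleC mult.commute\<close>)
qed

lemma bounded_clinear_compose:
  "bounded_clinear S \<Longrightarrow> bounded_clinear T \<Longrightarrow> bounded_clinear (\<lambda>x. S (T x))"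
  by (auto simp: bounded_clinear_def intro: bounded_linear_compose)

lemma bounded_clinear_plus:
  "bounded_clinear S \<Longrightarrow> bounded_clinear T \<Longrightarrow> bounded_clinear (\<lambda>x. S x + T x)"
  by (auto simp: bounded_clinear_def scaleC_add_right intro: bounded_linear_add)

lemma bounded_clinear_scale:
  fixes T :: "'a::complex_inner \<Rightarrow> 'a"
  assumes "bounded_clinear T"
  shows "bounded_clinear (\<lambda>x. c *\<^sub>C T x)"
proof -
  obtain K where K: "\<And>x. norm (T x) \<le> norm x * K"
    using bounded_linear.bounded [OF bounded_clinear_imp_bounded_linear [OF assms]] by blast
  show ?thesis
  proof (rule bounded_clinearI [where K = "cmod c * K"])
    show "norm (c *\<^sub>C T x) \<le> cmod c * K * norm x" for x
      using mult_left_mono [OF K [of x], of "cmod c"] by (simp add: norm_scaleC mult_ac)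
  qed (use assms in \<open>simp_all add: bounded_clinear_simps scaleC_add_right scaleC_scaleC mult.commute\<close>)
qed

section \<open>Positive operators and the Cauchy-Schwarz inequality\<close>

lemma positive_op_bounded_clinear: "positive_op A \<Longrightarrow> bounded_clinear A"
  by (simp add: positive_op_def)

text \<open>Polarization: the form is real on the diagonal. Its value at \<open>x + y\<close> makes
  the imaginary parts of the two cross terms cancel, and its value at
  \<open>x + \<i> *\<^sub>C y\<close> makes their real parts agree.\<close>

lemma positive_op_hermitian:
  assumes "positive_op A"
  shows "cinner (A y) x = cnj (cinner (A x) y)"
proof -
  note lin = bounded_clinear_simps [OF positive_op_bounded_clinear [OF assms]]
  have im: "Im (cinner (A z) z) = 0" for z
    using assms by (auto simp: positive_op_def complex_nonneg_Reals_iff)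
  have "Im (cinner (A x) y + cinner (A y) x) = 0"
    using im [of "x + y"] im [of x] im [of y] by (simp add: lin cinner_simps)
  moreover have "Re (cinner (A y) x) = Re (cinner (A x) y)"
    using im [of "x + \<i> *\<^sub>C y"] im [of x] im [of y] by (simp add: lin cinner_simps)
  ultimately show ?thesis by (simp add: complex_eq_iff)
qed

lemma positive_op_selfadjoint: "positive_op A \<Longrightarrow> cinner (A x) y = cinner x (A y)"
  by (simp add: positive_op_hermitian [of A x y] cinner_commute [of x])

lemma norm_A_nonneg: "positive_op A \<Longrightarrow> 0 \<le> norm_A A x"
  by (auto simp: norm_A_def inner_A_def positive_op_def complex_nonneg_Reals_iff)

lemma cinner_A_self: "positive_op A \<Longrightarrow> cinner (A x) x = of_real ((norm_A A x)\<^sup>2)"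
  by (auto simp: norm_A_def inner_A_def positive_op_def complex_nonneg_Reals_iff complex_eq_iff)

text \<open>The quadratic has the shape of the squared norm of \<open>x + (t * h) y\<close> with
  \<open>b\<close> the squared modulus of \<open>h\<close>. For nonzero \<open>e\<close> it is
  evaluated at its critical point \<open>- 1 / e\<close>; for \<open>e = 0\<close> it is affine, and
  nonnegativity for all \<open>t\<close> forces \<open>b = 0\<close>.\<close>

lemma discriminant_bound:
  fixes a b e :: real
  assumes "\<And>t. 0 \<le> a + 2 * t * b + t\<^sup>2 * b * e" and "0 \<le> e"
  shows "b \<le> a * e"
proof (cases "e = 0")
  case True
  have "b = 0"
  proof (rule ccontr)
    assume "b \<noteq> 0"
    \<comment> \<open>At this \<open>t\<close> the affine function takes the value -1.\<close>
    then show False using assms(1) [of "- (a + 1) / (2 * b)"] True by (simp add: field_simps)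
  qed
  then show ?thesis using True by simp
next
  case False
  have "0 \<le> a + 2 * (- 1 / e) * b + (- 1 / e)\<^sup>2 * b * e" by (rule assms)
  also have "\<dots> = a - b / e" using False by (simp add: power2_eq_square)
  finally show ?thesis using False \<open>0 \<le> e\<close> by (simp add: pos_divide_le_eq)
qed

lemma cauchy_schwarz_A:
  assumes "positive_op A"
  shows "cmod (cinner (A x) y) \<le> norm_A A x * norm_A A y"
proof -
  note lin = bounded_clinear_simps [OF positive_op_bounded_clinear [OF assms]]
  define h where "h = cinner (A x) y"
  have "0 \<le> (norm_A A x)\<^sup>2 + 2 * t * (cmod h)\<^sup>2 + t\<^sup>2 * (cmod h)\<^sup>2 * (norm_A A y)\<^sup>2" for t
  proof -
    \<comment> \<open>Including the factor \<open>h\<close> makes both cross terms equal to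
      \<open>t\<close> times the squared modulus of \<open>h\<close>, so a real parameter suffices
      and no phase has to be chosen.\<close>
    define z where "z = x + (of_real t * h) *\<^sub>C y"
    have hh: "h * cnj h = of_real ((cmod h)\<^sup>2)" by (simp add: complex_norm_square [symmetric])
    have "of_real ((norm_A A z)\<^sup>2) = cinner (A z) z"
      by (simp add: cinner_A_self assms)
    also have "\<dots> = cinner (A x) x + 2 * of_real t * (h * cnj h)
        + (of_real t)\<^sup>2 * (h * cnj h) * cinner (A y) y"
      by (simp add: z_def lin cinner_simps positive_op_hermitian [OF assms, of y x]
          h_def [symmetric] algebra_simps power2_eq_square)
    also have "\<dots> = of_real ((norm_A A x)\<^sup>2 + 2 * t * (cmod h)\<^sup>2
        + t\<^sup>2 * (cmod h)\<^sup>2 * (norm_A A y)\<^sup>2)"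
      by (simp add: hh cinner_A_self assms)
    finally have "(norm_A A z)\<^sup>2 = (norm_A A x)\<^sup>2 + 2 * t * (cmod h)\<^sup>2
        + t\<^sup>2 * (cmod h)\<^sup>2 * (norm_A A y)\<^sup>2"
      unfolding of_real_eq_iff .
    then show ?thesis by (metis zero_le_power2)
  qed
  then have "(cmod h)\<^sup>2 \<le> (norm_A A x)\<^sup>2 * (norm_A A y)\<^sup>2"
    by (rule discriminant_bound) simp
  then have "(cmod h)\<^sup>2 \<le> (norm_A A x * norm_A A y)\<^sup>2"
    by (simp add: power_mult_distrib)
  then show ?thesis
    unfolding h_def by (rule power2_le_imp_le) (simp add: norm_A_nonneg assms)
qed

text \<open>Lets the ordinary Cauchy-Schwarz inequality be read off from the one for the
  A-seminorm.\<close>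

lemma positive_op_ident: "positive_op (\<lambda>x. x)"
  by (simp add: positive_op_def bounded_clinear_def cinner_self_nonneg)

lemma cauchy_schwarz: "cmod (cinner x y) \<le> norm x * norm y"
  using cauchy_schwarz_A [OF positive_op_ident, of x y]
  by (simp add: norm_A_def inner_A_def norm_eq_sqrt_cinner)

lemma bounded_linear_cinner_left: "bounded_linear (\<lambda>x. cinner x y)"
  by (rule bounded_linear_intro [where K = "norm y"])
    (auto simp: cinner_simps scaleR_scaleC cauchy_schwarz scaleR_conv_of_real scaleC_complex_def)

lemma bounded_linear_cinner_right: "bounded_linear (\<lambda>y. cinner x y)"
  by (rule bounded_linear_intro [where K = "norm x"])
    (use cauchy_schwarz [of x] in \<open>auto simp: cinner_simps scaleR_scaleC scaleR_conv_of_real scaleC_complex_def mult.commute\<close>)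

section \<open>Orthogonal projection onto closed subspaces\<close>

lemma norm_diff_power2:
  "(norm (x - y))\<^sup>2 = (norm x)\<^sup>2 + (norm (y::'a::complex_inner))\<^sup>2 - 2 * Re (cinner x y)"
proof -
  have "complex_of_real ((norm (x - y))\<^sup>2) = 
     of_real ((norm x)\<^sup>2) + of_real ((norm y)\<^sup>2) - (cinner x y + cnj (cinner x y))"
    unfolding cinner_self [symmetric] by (simp add: cinner_simps cinner_commute [of y x])
  then have "complex_of_real ((norm (x - y))\<^sup>2) = 
     of_real ((norm x)\<^sup>2 + (norm y)\<^sup>2 - 2 * Re (cinner x y))"
    by (simp add: complex_add_cnj)
  then show ?thesis unfolding of_real_eq_iff .
qed

lemma parallelogram_law:
  fixes x y :: "'a::complex_inner"
  shows "(norm (x + y))\<^sup>2 + (norm (x - y))\<^sup>2 = 2 * (norm x)\<^sup>2 + 2 * (norm y)\<^sup>2"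
  using norm_diff_power2 [of x y] norm_diff_power2 [of x "- y"] by (simp add: cinner_minus_right)

locale closed_csubspace =
  fixes M :: "'a::chilbert_space set"
  assumes closed: "closed M"
    and zero: "0 \<in> M"
    and add: "x \<in> M \<Longrightarrow> y \<in> M \<Longrightarrow> x + y \<in> M"
    and scale: "x \<in> M \<Longrightarrow> c *\<^sub>C x \<in> M"
begin

text \<open>A minimizing sequence is Cauchy by the parallelogram law, because midpoints stay in
  \<open>M\<close>; completeness and closedness provide the limit.\<close>

lemma exists_nearest:
  obtains p where "p \<in> M" "\<And>m. m \<in> M \<Longrightarrow> norm (x - p) \<le> norm (x - m)"
proof -
  define d where "d = (INF m\<in>M. (norm (x - m))\<^sup>2)"
  have bdd: "bdd_below ((\<lambda>m. (norm (x - m))\<^sup>2) ` M)" by (rule bdd_belowI2 [of _ 0]) simp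
  have lower: "d \<le> (norm (x - m))\<^sup>2" if "m \<in> M" for m
    unfolding d_def by (rule cINF_lower [OF bdd that])
  have "\<exists>m\<in>M. (norm (x - m))\<^sup>2 < d + 1 / Suc n" for n
    using cINF_less_iff [OF _ bdd, of "d + 1 / Suc n"] zero
    unfolding d_def by auto
  then obtain s where s: "\<And>n. s n \<in> M" "\<And>n. (norm (x - s n))\<^sup>2 < d + 1 / Suc n"
    by metis
  have close: "(norm (s m - s n))\<^sup>2 < 2 * (1 / Suc m) + 2 * (1 / Suc n)" for m n
  proof -
    \<comment> \<open>The midpoint lies in \<open>M\<close>, so its squared distance to
      \<open>x\<close> is at least \<open>d\<close>; in the parallelogram law this cancels the two
      terms close to \<open>d\<close>.\<close>
    define w where "w = (1/2) *\<^sub>R (s m + s n)"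
    have "w \<in> M" unfolding w_def scaleR_scaleC by (intro scale add s)
    have "(x - s m) + (x - s n) = 2 *\<^sub>R (x - w)"
      by (simp add: w_def algebra_simps scaleR_2)
    then have "(norm ((x - s m) + (x - s n)))\<^sup>2 = 4 * (norm (x - w))\<^sup>2"
      by (simp add: power_mult_distrib)
    moreover have "norm ((x - s m) - (x - s n)) = norm (s m - s n)"
      by (simp add: norm_minus_commute)
    ultimately have "(norm (s m - s n))\<^sup>2
        = 2 * (norm (x - s m))\<^sup>2 + 2 * (norm (x - s n))\<^sup>2 - 4 * (norm (x - w))\<^sup>2"
      using parallelogram_law [of "x - s m" "x - s n"] by simp
    then show ?thesis
      using lower [OF \<open>w \<in> M\<close>] s(2) [of m] s(2) [of n] by linarith
  qed
  have "Cauchy s"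
  proof (rule metric_CauchyI)
    fix e :: real assume "0 < e"
    then obtain N where N: "4 / e\<^sup>2 < real N" using reals_Archimedean2 by blast
    then have "4 < real N * e\<^sup>2" using \<open>0 < e\<close> by (simp add: pos_divide_less_eq)
    also have "\<dots> \<le> real (Suc N) * e\<^sup>2" by (intro mult_right_mono) auto
    finally have N': "4 * (1 / Suc N) < e\<^sup>2" by (simp add: pos_divide_less_eq mult.commute)
    have "dist (s m) (s n) < e" if "m \<ge> N" "n \<ge> N" for m n
    proof -
      have "1 / Suc m \<le> 1 / Suc N" "1 / Suc n \<le> 1 / Suc N"
        using that by (auto intro!: divide_left_mono)
      then have "(norm (s m - s n))\<^sup>2 < e\<^sup>2" using close [of m n] N' by linarith
      then show ?thesis using \<open>0 < e\<close> by (simp add: dist_norm power2_less_imp_less)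
    qed
    then show "\<exists>N. \<forall>m\<ge>N. \<forall>n\<ge>N. dist (s m) (s n) < e" by blast
  qed
  then obtain p where p: "s \<longlonglongrightarrow> p" using Cauchy_convergent convergent_def by blast
  then have "p \<in> M" using closed s(1) closed_sequentially by blast
  have "(\<lambda>n. (norm (x - s n))\<^sup>2) \<longlonglongrightarrow> (norm (x - p))\<^sup>2"
    by (intro tendsto_intros p)
  moreover have "(\<lambda>n. d + 1 / Suc n) \<longlonglongrightarrow> d + 0"
    by (intro tendsto_intros LIMSEQ_Suc [OF lim_1_over_n])
  ultimately have "(norm (x - p))\<^sup>2 \<le> d"
    using s(2) by (intro LIMSEQ_le) (auto intro: less_imp_le)
  then have "(norm (x - p))\<^sup>2 \<le> (norm (x - m))\<^sup>2" if "m \<in> M" for m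
    using lower [OF that] by (rule order_trans)
  then show ?thesis using \<open>p \<in> M\<close> that by (meson power2_le_imp_le norm_ge_zero)
qed

text \<open>The nearest point works: moving it along \<open>m\<close> cannot decrease the distance,
  which gives a nonnegative quadratic with constant term 0, and \<open>discriminant_bound\<close>
  then kills the linear coefficient.\<close>

lemma exists_projection:
  obtains p where "p \<in> M" "\<And>m. m \<in> M \<Longrightarrow> cinner (x - p) m = 0"
proof -
  obtain p where p: "p \<in> M" "\<And>m. m \<in> M \<Longrightarrow> norm (x - p) \<le> norm (x - m)"
    using exists_nearest by blast
  have "cinner (x - p) m = 0" if "m \<in> M" for m
  proof -
    define h where "h = cinner (x - p) m"
    have "0 \<le> 0 + 2 * t * (cmod h)\<^sup>2 + t\<^sup>2 * (cmod h)\<^sup>2 * (norm m)\<^sup>2" for t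
    proof -
      define u where "u = (- of_real t * h) *\<^sub>C m"
      have "(norm (x - p))\<^sup>2 \<le> (norm ((x - p) - u))\<^sup>2"
        using p(2) [of "p + u"] p(1) that by (simp add: u_def add scale diff_diff_eq)
      also have "\<dots> = (norm (x - p))\<^sup>2 + (norm u)\<^sup>2 - 2 * Re (cinner (x - p) u)"
        by (rule norm_diff_power2)
      also have "cinner (x - p) u = of_real (- t * (cmod h)\<^sup>2)"
        by (simp add: u_def cinner_scaleC_right h_def [symmetric] complex_norm_square mult.commute
            del: of_real_power)
      also have "(norm u)\<^sup>2 = t\<^sup>2 * (cmod h)\<^sup>2 * (norm m)\<^sup>2"
        by (simp add: u_def norm_scaleC norm_mult power_mult_distrib)
      finally show ?thesis by simp
    qed
    then have "(cmod h)\<^sup>2 \<le> 0 * (norm m)\<^sup>2" by (rule discriminant_bound) simp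
    then show ?thesis by (simp add: h_def)
  qed
  then show ?thesis using p that by blast
qed

end

section \<open>Riesz representation and the Hilbert space adjoint\<close>

text \<open>A vector \<open>q\<close> orthogonal to the kernel with \<open>f q\<close> nonzero
  represents \<open>f\<close> up to a scalar, since subtracting a suitable multiple of
  \<open>q\<close> moves any \<open>x\<close> into the kernel.\<close>

lemma riesz_representation:
  fixes f :: "'a::chilbert_space \<Rightarrow> complex"
  assumes f: "bounded_linear f" and f_scaleC: "\<And>c x. f (c *\<^sub>C x) = c * f x"
  obtains z where "\<And>x. f x = cinner x z"
proof (cases "\<forall>x. f x = 0")
  case True
  then show ?thesis using that [of 0] by simp
next
  case False
  then obtain x0 where x0: "f x0 \<noteq> 0" by blast
  interpret bounded_linear f by (rule f)
  interpret ker: closed_csubspace "{x. f x = 0}"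
    by unfold_locales (auto simp: add zero f_scaleC intro!: closed_Collect_eq continuous_intros linear_continuous_on f)
  obtain p where p: "f p = 0" "\<And>m. f m = 0 \<Longrightarrow> cinner (x0 - p) m = 0"
    using ker.exists_projection [of x0] by auto
  define q where "q = x0 - p"
  have fq: "f q \<noteq> 0" using x0 p by (simp add: q_def diff)
  then have qq: "cinner q q \<noteq> 0" using zero by (auto simp: cinner_eq_zero_iff)
  \<comment> \<open>The scalar is conjugated because the second argument of \<open>cinner\<close> is
    conjugate-linear.\<close>
  have "f x = cinner x (cnj (f q / cinner q q) *\<^sub>C q)" for x
  proof -
    have "f (x - (f x / f q) *\<^sub>C q) = 0" using fq by (simp add: diff f_scaleC)
    then have "cinner q (x - (f x / f q) *\<^sub>C q) = 0" unfolding q_def by (rule p)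
    then have "cinner (x - (f x / f q) *\<^sub>C q) q = 0"
      using cinner_commute [of "x - (f x / f q) *\<^sub>C q" q] by simp
    then have "cinner x q = f x / f q * cinner q q" by (simp add: cinner_simps)
    then show ?thesis using fq qq by (simp add: cinner_simps)
  qed
  then show ?thesis using that by blast
qed

text \<open>Riesz representation gives the value of \<open>S\<close> at each \<open>y\<close>;
  uniqueness of the representing vector makes \<open>S\<close> linear.\<close>

lemma cadjoint_exists:
  fixes T :: "'a::chilbert_space \<Rightarrow> 'a"
  assumes T: "bounded_clinear T"
  shows "\<exists>S. bounded_clinear S \<and> (\<forall>x y. cinner (T x) y = cinner x (S y))"
proof -
  note lin = bounded_clinear_simps [OF T]
  have "\<exists>z. \<forall>x. cinner (T x) y = cinner x z" for y
  proof -
    have "bounded_linear (\<lambda>x. cinner (T x) y)"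
      using bounded_linear_compose [OF bounded_linear_cinner_left bounded_clinear_imp_bounded_linear [OF T]] .
    then obtain z where "\<And>x. cinner (T x) y = cinner x z"
      using riesz_representation [of "\<lambda>x. cinner (T x) y"] by (auto simp: lin cinner_simps)
    then show ?thesis by blast
  qed
  then obtain S where S: "\<And>x y. cinner (T x) y = cinner x (S y)" by metis
  obtain K where K: "K > 0" "\<And>x. norm (T x) \<le> norm x * K"
    using bounded_linear.pos_bounded [OF bounded_clinear_imp_bounded_linear [OF T]] by blast
  have "bounded_clinear S"
  proof (rule bounded_clinearI)
    show "S (x + y) = S x + S y" for x y
      by (rule cinner_ext_right) (simp add: cinner_simps S [symmetric])
    show "S (c *\<^sub>C x) = c *\<^sub>C S x" for c x
      by (rule cinner_ext_right) (simp add: cinner_simps S [symmetric])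
    show "norm (S x) \<le> K * norm x" for x
    proof (cases "S x = 0")
      case False
      \<comment> \<open>Testing the adjoint relation on \<open>S x\<close> itself transfers the
        bound \<open>K\<close> from \<open>T\<close> to \<open>S\<close>, after cancelling one
        factor \<open>norm (S x)\<close>.\<close>
      have "norm (S x) * norm (S x) = cmod (cinner (T (S x)) x)"
        by (simp add: S cinner_self norm_mult power2_eq_square)
      also have "\<dots> \<le> norm (T (S x)) * norm x" by (rule cauchy_schwarz)
      also have "\<dots> \<le> norm (S x) * K * norm x" by (intro mult_right_mono K) simp
      finally show ?thesis using False by (simp add: mult.assoc)
    qed (use K in simp)
  qed
  then show ?thesis using S by blast
qed

text \<open>Existence together with uniqueness lets the definite description in
  \<open>cadjoint\<close> be unfolded.\<close>

lemma cadjoint: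
  assumes "bounded_clinear T"
  shows "bounded_clinear (cadjoint T)" and "cinner (T x) y = cinner x (cadjoint T y)"
proof -
  have ex1: "\<exists>!S. bounded_clinear S \<and> (\<forall>x y. cinner (T x) y = cinner x (S y))"
  proof (rule ex_ex1I [OF cadjoint_exists [OF assms]])
    fix S S'
    assume "bounded_clinear S \<and> (\<forall>x y. cinner (T x) y = cinner x (S y))"
      "bounded_clinear S' \<and> (\<forall>x y. cinner (T x) y = cinner x (S' y))"
    then have 1: "cinner (T x) y = cinner x (S y)" and 2: "cinner (T x) y = cinner x (S' y)" for x y
      by blast+
    show "S = S'"
    proof
      show "S y = S' y" for y
        by (rule cinner_ext_right) (rule trans [OF 1 [symmetric] 2])
    qed
  qed
  have "bounded_clinear (cadjoint T) \<and> (\<forall>x y. cinner (T x) y = cinner x (cadjoint T y))"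
    unfolding cadjoint_def by (rule theI' [OF ex1])
  then show "bounded_clinear (cadjoint T)" "cinner (T x) y = cinner x (cadjoint T y)"
    by blast+
qed

section \<open>The closure of the range of \<open>A\<close> and the A-adjoint\<close>

text \<open>Makes the projection theorem available for the closure of the range, where the values of
  the A-adjoint must lie.\<close>

lemma closed_csubspace_closure_range:
  fixes A :: "'a::chilbert_space \<Rightarrow> 'a"
  assumes "bounded_clinear A"
  shows "closed_csubspace (closure (range A))"
proof
  note lin = bounded_clinear_simps [OF assms]
  show "0 \<in> closure (range A)"
    by (rule closure_subset [THEN subsetD]) (metis lin(3) rangeI)
  show "x + y \<in> closure (range A)" if "x \<in> closure (range A)" "y \<in> closure (range A)" for x y
  proof -
    have "x + y \<in> closure (range A + range A)"
      using closure_sum [of "range A" "range A"] set_plus_intro [OF that] by blast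
    moreover have "range A + range A \<subseteq> range A"
      by (auto simp: set_plus_def lin(1) [symmetric])
    ultimately show ?thesis using closure_mono by blast
  qed
  show "c *\<^sub>C x \<in> closure (range A)" if "x \<in> closure (range A)" for c x
  proof -
    have "bounded_clinear (\<lambda>x. c *\<^sub>C (x::'a))"
      by (rule bounded_clinear_scale) (simp add: bounded_clinear_def)
    then have "continuous_on (closure (range A)) (\<lambda>x. c *\<^sub>C x)"
      using bounded_clinear_imp_bounded_linear linear_continuous_on by blast
    moreover have "(\<lambda>x. c *\<^sub>C x) ` range A \<subseteq> closure (range A)"
      using closure_subset [of "range A"] by (auto simp: lin(4) [symmetric])
    ultimately show ?thesis
      using image_closure_subset [of "range A" "\<lambda>x. c *\<^sub>C x" "closure (range A)"] that by auto
  qed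
qed auto

text \<open>The inequality passes from the range to its closure by continuity and can then be tested
  on \<open>z\<close> itself.\<close>

lemma norm_le_closure_range:
  assumes z: "z \<in> closure (range A)" and "0 \<le> C"
    and le: "\<And>w. cmod (cinner z (A w)) \<le> C * norm (A w)"
  shows "norm z \<le> C"
proof (cases "z = 0")
  case False
  have "closed {m. cmod (cinner z m) \<le> C * norm m}"
    by (intro closed_Collect_le continuous_intros
        bounded_linear.continuous_on [OF bounded_linear_cinner_right])
  then have "closure (range A) \<subseteq> {m. cmod (cinner z m) \<le> C * norm m}"
    by (rule closure_minimal [rotated]) (use le in auto)
  then have "cmod (cinner z z) \<le> C * norm z" using z by auto
  then show ?thesis using False by (simp add: cinner_self norm_mult power2_eq_square)
qed (use \<open>0 \<le> C\<close> in simp)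

text \<open>The difference \<open>u - v\<close> is orthogonal to the range of \<open>A\<close> by
  self-adjointness and lies in the closure of that range, so the preceding bound applies with
  constant 0.\<close>

lemma closure_range_eqI:
  fixes A :: "'a::chilbert_space \<Rightarrow> 'a"
  assumes A: "positive_op A" and "u \<in> closure (range A)" "v \<in> closure (range A)" and eq: "A u = A v"
  shows "u = v"
proof -
  interpret closed_csubspace "closure (range A)"
    by (rule closed_csubspace_closure_range [OF positive_op_bounded_clinear [OF A]])
  have "u + (-1) *\<^sub>C v \<in> closure (range A)" by (intro add scale assms)
  moreover have "(-1) *\<^sub>C v = - v" using scaleR_scaleC [of "-1" v] by simp
  ultimately have mem: "u - v \<in> closure (range A)" by simp
  have "norm (u - v) \<le> 0"
  proof (rule norm_le_closure_range [OF mem])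
    show "cmod (cinner (u - v) (A w)) \<le> 0 * norm (A w)" for w
      by (simp add: cinner_diff_left positive_op_selfadjoint [OF A, symmetric] eq
          bounded_clinear_diff [OF positive_op_bounded_clinear [OF A]])
  qed simp
  then show ?thesis by simp
qed

text \<open>The pointwise solutions depend linearly on the argument by uniqueness; boundedness is the
  closed graph theorem, obtained here from Baire category applied to the closed sets
  \<open>{y. norm (X y) \<le> n}\<close>.\<close>

lemma sharp_exists:
  fixes A T :: "'a::chilbert_space \<Rightarrow> 'a"
  assumes A: "positive_op A" and T: "T \<in> B_A A"
  shows "\<exists>X. bounded_clinear X \<and> A \<circ> X = cadjoint T \<circ> A \<and> range X \<subseteq> closure (range A)"
proof -
  have bT: "bounded_clinear T" using T by (simp add: B_A_def)
  note linA = bounded_clinear_simps [OF positive_op_bounded_clinear [OF A]]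
  note linT' = bounded_clinear_simps [OF cadjoint(1) [OF bT]]
  interpret M: closed_csubspace "closure (range A)"
    by (rule closed_csubspace_closure_range [OF positive_op_bounded_clinear [OF A]])
  \<comment> \<open>Any preimage \<open>u\<close> is replaced by its projection \<open>p\<close>:
    the remainder \<open>u - p\<close> is orthogonal to the range of \<open>A\<close>, hence
    annihilated by \<open>A\<close>.\<close>
  have "\<exists>p. p \<in> closure (range A) \<and> A p = cadjoint T (A y)" for y
  proof -
    have "cadjoint T (A y) \<in> range A" using T by (auto simp: B_A_def)
    then obtain u where u: "cadjoint T (A y) = A u" by blast
    obtain p where p: "p \<in> closure (range A)" "\<And>m. m \<in> closure (range A) \<Longrightarrow> cinner (u - p) m = 0"
      using M.exists_projection by blast
    have "A (u - p) = 0"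
    proof (rule cinner_ext_left)
      show "cinner (A (u - p)) w = cinner 0 w" for w
        using p(2) [of "A w"] closure_subset [of "range A"]
        by (auto simp: positive_op_selfadjoint [OF A])
    qed
    then show ?thesis using p(1) u by (auto simp: linA)
  qed
  then obtain X where X: "\<And>y. X y \<in> closure (range A)" "\<And>y. A (X y) = cadjoint T (A y)"
    by metis
  have add: "X (x + y) = X x + X y" for x y
    by (rule closure_range_eqI [OF A]) (simp_all add: X M.add linA linT')
  have scale: "X (c *\<^sub>C x) = c *\<^sub>C X x" for c x
    by (rule closure_range_eqI [OF A]) (simp_all add: X M.scale linA linT')
  have diff: "X (x - y) = X x - X y" for x y
    using add [of "x - y" y] by (simp add: eq_diff_eq)
  have adj: "cinner (X y) (A w) = cinner y (A (T w))" for y w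
  proof -
    have "cinner (X y) (A w) = cinner (cadjoint T (A y)) w"
      by (simp add: positive_op_selfadjoint [OF A, symmetric] X)
    also have "\<dots> = cinner (A y) (T w)"
      by (simp add: cinner_commute [of "cadjoint T (A y)"] cadjoint(2) [OF bT, symmetric] cinner_commute [of "A y"])
    finally show ?thesis by (simp add: positive_op_selfadjoint [OF A])
  qed
  define F where "F n = {y. norm (X y) \<le> real n}" for n
  \<comment> \<open>By \<open>adj\<close> the condition on \<open>X y\<close> becomes a family of
    conditions on \<open>y\<close> alone, each continuous in \<open>y\<close>. Closedness of
    \<open>F n\<close> thus follows before \<open>X\<close> is known to be continuous.\<close>
  have "F n = (\<Inter>w. {y. cmod (cinner y (A (T w))) \<le> real n * norm (A w)})" for n
  proof (intro set_eqI iffI)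
    fix y assume "y \<in> F n"
    then have "cmod (cinner (X y) (A w)) \<le> real n * norm (A w)" for w
      by (intro order_trans [OF cauchy_schwarz] mult_right_mono) (simp_all add: F_def)
    then show "y \<in> (\<Inter>w. {y. cmod (cinner y (A (T w))) \<le> real n * norm (A w)})"
      by (simp add: adj)
  next
    fix y assume "y \<in> (\<Inter>w. {y. cmod (cinner y (A (T w))) \<le> real n * norm (A w)})"
    then show "y \<in> F n"
      unfolding F_def by (auto simp: adj intro!: norm_le_closure_range [OF X(1)])
  qed
  then have "closed (F n)" for n
    by (simp only:) (intro closed_INT ballI closed_Collect_le continuous_intros
        bounded_linear.continuous_on [OF bounded_linear_cinner_left])
  moreover have "(\<Union>n. F n) = UNIV"
    by (auto simp: F_def intro: real_arch_simple)
  ultimately obtain n where "interior (F n) \<noteq> {}"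
    using Baire_category_alt [of "euclidean :: 'a topology" "range F"]
    by (auto simp: completely_metrizable_space_euclidean)
  then obtain y0 r where r: "r > 0" "ball y0 r \<subseteq> F n"
    by (metis ex_in_conv mem_interior)
  \<comment> \<open>Translating the ball to the origin costs a factor 2, since \<open>X h\<close> is
    a difference of two values bounded by \<open>n\<close>.\<close>
  have small: "norm (X h) \<le> 2 * real n" if "norm h < r" for h
  proof -
    have "y0 \<in> F n" "y0 + h \<in> F n" using r that by (auto simp: dist_norm subset_iff)
    then have "norm (X y0) \<le> real n" "norm (X (y0 + h)) \<le> real n" by (auto simp: F_def)
    moreover have "X h = X (y0 + h) - X y0" by (simp add: diff [symmetric])
    ultimately show ?thesis using norm_triangle_ineq4 [of "X (y0 + h)" "X y0"] by simp
  qed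
  have bound: "norm (X x) \<le> 4 * real n / r * norm x" for x
  proof (cases "x = 0")
    case True
    then show ?thesis using diff [of 0 0] by simp
  next
    case False
    \<comment> \<open>Scales \<open>x\<close> to norm \<open>r / 2\<close>, inside the ball;
      dividing \<open>2 * real n\<close> by \<open>t\<close> yields the constant
      \<open>4 * real n / r\<close>.\<close>
    define t where "t = r / (2 * norm x)"
    have "t > 0" using False r by (simp add: t_def)
    have "X (complex_of_real t *\<^sub>C x) = t *\<^sub>R X x" by (simp add: scale scaleR_scaleC)
    moreover have "norm (complex_of_real t *\<^sub>C x) < r"
      using False r \<open>t > 0\<close> by (simp add: norm_scaleC) (simp add: t_def)
    ultimately have "t * norm (X x) \<le> 2 * real n" using small \<open>t > 0\<close> by fastforce
    then show ?thesis using False r by (simp add: t_def field_simps)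
  qed
  have "bounded_clinear X" by (rule bounded_clinearI [OF add scale bound])
  then show ?thesis using X by (intro exI [of _ X]) auto
qed

text \<open>Uniqueness holds because \<open>A\<close> is injective on the closure of its range, so
  the definite description denotes the operator constructed above.\<close>

lemma sharp:
  fixes A T :: "'a::chilbert_space \<Rightarrow> 'a"
  assumes A: "positive_op A" and T: "T \<in> B_A A"
  shows "bounded_clinear (sharp A T)" and "cinner (A (T x)) y = cinner (A x) (sharp A T y)"
proof -
  have bT: "bounded_clinear T" using T by (simp add: B_A_def)
  have ex1: "\<exists>!X. bounded_clinear X \<and> A \<circ> X = cadjoint T \<circ> A \<and> range X \<subseteq> closure (range A)"
  proof (rule ex_ex1I [OF sharp_exists [OF A T]])
    fix X Y
    assume *: "bounded_clinear X \<and> A \<circ> X = cadjoint T \<circ> A \<and> range X \<subseteq> closure (range A)"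
      "bounded_clinear Y \<and> A \<circ> Y = cadjoint T \<circ> A \<and> range Y \<subseteq> closure (range A)"
    then have "A (X y) = A (Y y)" for y by (metis comp_apply)
    then have "X y = Y y" for y using * by (intro closure_range_eqI [OF A, of "X y" "Y y"]) auto
    then show "X = Y" ..
  qed
  have *: "bounded_clinear (sharp A T) \<and> A \<circ> sharp A T = cadjoint T \<circ> A
      \<and> range (sharp A T) \<subseteq> closure (range A)"
    unfolding sharp_def by (rule theI' [OF ex1])
  then show "bounded_clinear (sharp A T)" by blast
  have "A (sharp A T y) = cadjoint T (A y)" using * by (metis comp_apply)
  then show "cinner (A (T x)) y = cinner (A x) (sharp A T y)"
    by (simp add: positive_op_selfadjoint [OF A] cadjoint(2) [OF bT])
qed

section \<open>Boundedness of symmetric operators in the A-seminorm\<close>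

text \<open>By symmetry of \<open>S\<close> the sequence \<open>norm_A A ((S ^^ n) x)\<close> is logarithmically convex, so it
  grows at least like the powers of its first ratio, while the operator norm bounds its growth.\<close>

lemma symmetric_imp_A_bounded:
  fixes A S :: "'a::complex_inner \<Rightarrow> 'a"
  assumes A: "positive_op A" and S: "bounded_clinear S"
    and sym: "\<And>x y. cinner (A (S x)) y = cinner (A x) (S y)"
  obtains K where "\<And>x. norm_A A (S x) \<le> K * norm_A A x"
proof -
  obtain K where K: "K > 0" "\<And>x. norm (S x) \<le> norm x * K"
    using bounded_linear.pos_bounded [OF bounded_clinear_imp_bounded_linear [OF S]] by blast
  obtain L where L: "L > 0" "\<And>x. norm (A x) \<le> norm x * L"
    using bounded_linear.pos_bounded
      [OF bounded_clinear_imp_bounded_linear [OF positive_op_bounded_clinear [OF A]]] by blast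
  have step: "(norm_A A (S x))\<^sup>2 \<le> norm_A A x * norm_A A (S (S x))" for x
  proof -
    have "(norm_A A (S x))\<^sup>2 = cmod (cinner (A (S x)) (S x))"
      by (simp add: cinner_A_self [OF A] norm_power norm_A_nonneg [OF A])
    also have "\<dots> = cmod (cinner (A x) (S (S x)))" by (simp add: sym)
    also have "\<dots> \<le> norm_A A x * norm_A A (S (S x))" by (rule cauchy_schwarz_A [OF A])
    finally show ?thesis .
  qed
  \<comment> \<open>The bound \<open>K\<close> for the ordinary norm serves for the A-seminorm as
    well; a single violation would be amplified by iteration.\<close>
  have "norm_A A (S x) \<le> K * norm_A A x" for x
  proof (rule ccontr)
    assume gt: "\<not> norm_A A (S x) \<le> K * norm_A A x"
    define c where "c n = norm_A A ((S ^^ n) x)" for n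
    have c_nonneg: "c n \<ge> 0" for n by (simp add: c_def norm_A_nonneg [OF A])
    have convex: "(c (Suc n))\<^sup>2 \<le> c n * c (Suc (Suc n))" for n
      using step by (simp add: c_def)
    have c1: "c 1 > K * c 0" using gt by (simp add: c_def)
    have c0: "c 0 > 0"
    proof (rule ccontr)
      assume "\<not> c 0 > 0"
      then have "c 0 = 0" using c_nonneg [of 0] by simp
      then show False using convex [of 0] c1 by simp
    qed
    define r where "r = c 1 / c 0"
    have r: "r > K" using c0 c1 by (simp add: r_def pos_less_divide_eq)
    \<comment> \<open>Log-convexity says that successive ratios do not decrease, so the first ratio
      \<open>r\<close> is a lower bound for all; a vanishing \<open>c n\<close> forces the next term
      to vanish too.\<close>
    have ratio: "r * c n \<le> c (Suc n)" for n
    proof (induction n)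
      case 0
      then show ?case using c0 by (simp add: r_def)
    next
      case (Suc n)
      show ?case
      proof (cases "c n = 0")
        case True
        then have "c (Suc n) = 0" using convex [of n] by simp
        then show ?thesis using c_nonneg by simp
      next
        case False
        then have "c n > 0" using c_nonneg [of n] by simp
        have "c n * (r * c (Suc n)) = r * c n * c (Suc n)" by simp
        also have "\<dots> \<le> c (Suc n) * c (Suc n)" by (intro mult_right_mono Suc.IH c_nonneg)
        also have "\<dots> \<le> c n * c (Suc (Suc n))" using convex [of n] by (simp add: power2_eq_square)
        finally show ?thesis using \<open>c n > 0\<close> by simp
      qed
    qed
    have lower: "r ^ n * c 0 \<le> c n" for n
    proof (induction n)
      case (Suc n)
      have "r ^ Suc n * c 0 = r * (r ^ n * c 0)" by simp
      also have "\<dots> \<le> r * c n" using r K by (intro mult_left_mono Suc.IH) simp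
      finally show ?case using ratio [of n] by simp
    qed simp
    have pow: "norm ((S ^^ n) x) \<le> K ^ n * norm x" for n
    proof (induction n)
      case (Suc n)
      have "norm ((S ^^ Suc n) x) \<le> norm ((S ^^ n) x) * K" using K by simp
      also have "\<dots> \<le> K ^ n * norm x * K" using K by (intro mult_right_mono Suc.IH) simp
      finally show ?case by (simp add: mult_ac)
    qed simp
    have upper: "c n \<le> K ^ n * (sqrt L * norm x)" for n
    proof (rule power2_le_imp_le)
      have "(c n)\<^sup>2 = cmod (cinner (A ((S ^^ n) x)) ((S ^^ n) x))"
        by (simp add: c_def cinner_A_self [OF A] norm_power norm_A_nonneg [OF A])
      also have "\<dots> \<le> norm (A ((S ^^ n) x)) * norm ((S ^^ n) x)" by (rule cauchy_schwarz)
      also have "\<dots> \<le> norm ((S ^^ n) x) * L * norm ((S ^^ n) x)" by (intro mult_right_mono L) simp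
      also have "\<dots> = L * (norm ((S ^^ n) x))\<^sup>2" by (simp add: power2_eq_square)
      also have "\<dots> \<le> L * (K ^ n * norm x)\<^sup>2" using L by (intro mult_left_mono power_mono pow) auto
      also have "\<dots> = (K ^ n * (sqrt L * norm x))\<^sup>2" using L by (simp add: power_mult_distrib)
      finally show "(c n)\<^sup>2 \<le> (K ^ n * (sqrt L * norm x))\<^sup>2" .
      show "0 \<le> K ^ n * (sqrt L * norm x)" using K L by simp
    qed
    \<comment> \<open>Lower and upper growth bounds clash: the powers of \<open>r / K\<close> are
      unbounded, yet they would have to stay below a constant.\<close>
    have "1 < r / K" using r K by simp
    then obtain n where n: "sqrt L * norm x / c 0 < (r / K) ^ n" using real_arch_pow by blast
    have "r ^ n * c 0 \<le> K ^ n * (sqrt L * norm x)" using lower upper order_trans by blast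
    then have "(r / K) ^ n * c 0 \<le> sqrt L * norm x"
      using K by (simp add: power_divide pos_divide_le_eq mult.commute)
    moreover have "sqrt L * norm x < (r / K) ^ n * c 0" using n c0 by (simp add: pos_divide_less_eq)
    ultimately show False by simp
  qed
  then show ?thesis using that by blast
qed

section \<open>Unit vectors and the Davis-Wielandt estimate\<close>

text \<open>If \<open>A x\<close> is nonzero then so is the seminorm of \<open>x\<close>, by
  Cauchy-Schwarz against \<open>A x\<close>, and \<open>x\<close> can be normalized. This makes the
  index set of the suprema nonempty.\<close>

lemma exists_norm_A_eq_1:
  assumes A: "positive_op A" and "A \<noteq> (\<lambda>x. 0)"
  obtains x where "norm_A A x = 1"
proof -
  obtain x where x: "A x \<noteq> 0" using assms(2) by blast
  have "norm_A A x \<noteq> 0"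
  proof
    assume "norm_A A x = 0"
    then have "cinner (A x) (A x) = 0" using cauchy_schwarz_A [OF A, of x "A x"] by simp
    then show False using x by (simp add: cinner_eq_zero_iff)
  qed
  then have pos: "norm_A A x > 0" using norm_A_nonneg [OF A, of x] by simp
  define c where "c = complex_of_real (1 / norm_A A x)"
  have "of_real ((norm_A A (c *\<^sub>C x))\<^sup>2) = c * cnj c * cinner (A x) x"
    by (simp add: cinner_A_self [OF A, symmetric] cinner_simps
        bounded_clinear_scaleC [OF positive_op_bounded_clinear [OF A]] del: of_real_power)
  also have "\<dots> = 1"
    using pos by (simp add: c_def cinner_A_self [OF A] power2_eq_square)
  finally have "(norm_A A (c *\<^sub>C x))\<^sup>2 = 1" by (simp only: of_real_eq_1_iff)
  then show ?thesis using that norm_A_nonneg [OF A, of "c *\<^sub>C x"] by (auto simp: power2_eq_1_iff)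
qed

theorem theorem2p10:
  fixes A T :: "'a::chilbert_space \<Rightarrow> 'a"
  assumes "positive_op A" and "A \<noteq> (\<lambda>x. 0)"
    and "T \<in> B_A A"
  shows "davis_wielandt_A A T \<le>
    sqrt (1/2 * omega_A A (\<lambda>x. (sharp A T \<circ> T) x + 2 *\<^sub>C ((sharp A T \<circ> T) ^^ 2) x
                              + (T \<circ> sharp A T) x)
        - 1/2 * (INF x\<in>{x. norm_A A x = 1}. (norm_A A (T x) - norm_A A (sharp A T x))\<^sup>2))"
proof -
  note A = assms(1)
  note linA = bounded_clinear_simps [OF positive_op_bounded_clinear [OF A]]
  note cs = cauchy_schwarz_A [OF A]
  define U where "U = sharp A T"
  define S where "S x = (U \<circ> T) x + 2 *\<^sub>C ((U \<circ> T) ^^ 2) x + (T \<circ> U) x" for x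
  have S: "S x = U (T x) + 2 *\<^sub>C U (T (U (T x))) + T (U x)" for x
    by (simp add: S_def numeral_2_eq_2)
  have bT: "bounded_clinear T" using assms(3) by (simp add: B_A_def)
  have bU: "bounded_clinear U" unfolding U_def by (rule sharp [OF A assms(3)])
  have adj: "cinner (A (T x)) y = cinner (A x) (U y)" for x y
    unfolding U_def by (rule sharp [OF A assms(3)])
  have adj': "cinner (A (U x)) y = cinner (A x) (T y)" for x y
    using adj [of y x] by (simp add: positive_op_hermitian [OF A, of "U x" y]
        positive_op_hermitian [OF A, of x "T y"])
  \<comment> \<open>Both \<open>U (T x)\<close> and \<open>T (U x)\<close> define A-symmetric
    operators since \<open>T\<close> and \<open>U\<close> are A-adjoint to each other, and the
    coefficient 2 is real.\<close>
  have sym: "cinner (A (S x)) y = cinner (A x) (S y)" for x y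
    by (simp add: S linA cinner_simps adj adj')
  note UT = bounded_clinear_compose [OF bU bT] and TU = bounded_clinear_compose [OF bT bU]
  have "bounded_clinear (\<lambda>x. U (T x) + 2 *\<^sub>C U (T (U (T x))) + T (U x))"
    by (rule bounded_clinear_plus [OF bounded_clinear_plus
          [OF UT bounded_clinear_scale [OF bounded_clinear_compose [OF UT UT]]] TU])
  then have "bounded_clinear S" by (simp only: S [symmetric])
  then obtain K where K: "\<And>x. norm_A A (S x) \<le> K * norm_A A x"
    using symmetric_imp_A_bounded [OF A _ sym] by blast
  let ?B = "{x. norm_A A x = 1}"
  have omega: "cmod (inner_A A (S x) x) \<le> omega_A A S" if "norm_A A x = 1" for x
    unfolding omega_A_def
  proof (rule cSUP_upper)
    show "bdd_above ((\<lambda>x. cmod (inner_A A (S x) x)) ` ?B)"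
    proof (rule bdd_aboveI2)
      show "cmod (inner_A A (S x) x) \<le> K" if "x \<in> ?B" for x
        using cs [of "S x" x] K [of x] that by (simp add: inner_A_def)
    qed
  qed (use that in simp)
  define i where "i = (INF x\<in>?B. (norm_A A (T x) - norm_A A (U x))\<^sup>2)"
  have inf: "i \<le> (norm_A A (T x) - norm_A A (U x))\<^sup>2" if "norm_A A x = 1" for x
    unfolding i_def by (rule cINF_lower) (use that in \<open>auto intro: bdd_belowI2 [of _ 0]\<close>)
  have main: "sqrt ((cmod (inner_A A (T x) x))\<^sup>2 + norm_A A (T x) ^ 4)
      \<le> sqrt (1/2 * omega_A A S - 1/2 * i)" if x: "norm_A A x = 1" for x
  proof -
    define a b d where "a = norm_A A (T x)" and "b = norm_A A (U x)" and "d = norm_A A (U (T x))"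
    have nn: "a \<ge> 0" "b \<ge> 0" "d \<ge> 0" by (simp_all add: a_def b_def d_def norm_A_nonneg [OF A])
    have "cmod (inner_A A (T x) x) \<le> a"
      using cs [of "T x" x] x by (simp add: inner_A_def a_def)
    moreover have "cmod (inner_A A (T x) x) \<le> b"
      using cs [of x "U x"] x by (simp add: inner_A_def b_def adj)
    ultimately have "(cmod (inner_A A (T x) x))\<^sup>2 \<le> a * b"
      unfolding power2_eq_square using nn by (intro mult_mono) auto
    also have "a * b = (a\<^sup>2 + b\<^sup>2) / 2 - (a - b)\<^sup>2 / 2"
      by (simp add: power2_diff field_simps)
    finally have 1: "(cmod (inner_A A (T x) x))\<^sup>2 \<le> (a\<^sup>2 + b\<^sup>2) / 2 - (a - b)\<^sup>2 / 2" .
    have "a\<^sup>2 = cmod (cinner (A (T x)) (T x))"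
      by (simp add: a_def cinner_A_self [OF A] norm_power norm_A_nonneg [OF A])
    also have "\<dots> \<le> d" using cs [of x "U (T x)"] x by (simp add: d_def adj)
    finally have "(a\<^sup>2)\<^sup>2 \<le> d\<^sup>2" by (intro power_mono) auto
    then have 2: "a ^ 4 \<le> d\<^sup>2" by simp
    \<comment> \<open>Moving the outer operators across the form turns the three summands into the
      squared seminorms of \<open>T x\<close>, \<open>U (T x)\<close> and
      \<open>U x\<close>.\<close>
    have "inner_A A (S x) x = cinner (A (T x)) (T x)
        + 2 * cinner (A (U (T x))) (U (T x)) + cinner (A (U x)) (U x)"
      by (simp add: inner_A_def S linA cinner_simps adj adj')
    also have "\<dots> = of_real (a\<^sup>2 + 2 * d\<^sup>2 + b\<^sup>2)"
      by (simp add: cinner_A_self [OF A] a_def b_def d_def)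
    finally have "cmod (inner_A A (S x) x) = a\<^sup>2 + 2 * d\<^sup>2 + b\<^sup>2"
      by (simp only: norm_of_real) simp
    then have "a\<^sup>2 + 2 * d\<^sup>2 + b\<^sup>2 \<le> omega_A A S" using omega [OF x] by simp
    moreover have "i \<le> (a - b)\<^sup>2" using inf [OF x] by (simp add: a_def b_def)
    ultimately have "(cmod (inner_A A (T x) x))\<^sup>2 + a ^ 4 \<le> 1/2 * omega_A A S - 1/2 * i"
      using 1 2 by argo
    then show ?thesis unfolding a_def by (rule real_sqrt_le_mono)
  qed
  \<comment> \<open>A real supremum is bounded by a common upper bound of its values only over a
    nonempty index set, which \<open>x0\<close> witnesses.\<close>
  obtain x0 where "norm_A A x0 = 1" using exists_norm_A_eq_1 [OF A assms(2)] by blast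
  then have "davis_wielandt_A A T \<le> sqrt (1/2 * omega_A A S - 1/2 * i)"
    unfolding davis_wielandt_A_def by (intro cSUP_least) (use main in auto)
  then show ?thesis unfolding S_def i_def U_def .
qed

end
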